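(* Let $p\equiv 1 \pmod 4$ be prime, let $m,n$ be integers with $p=m^2+n^2$, and let $b$ be a positive integer. Define integers $a_t$ ($t\in\mathbb{Z}$) by the Laurent series expansion \[ Q(q^{bm},q^{p})\,Q(q^{bn},q^{p})=\sum_{t=-\infty}^{\infty}a_t q^t . \] Let $w$ be an integer with $2w\equiv m+n \pmod p$, and let $\bar m,\bar n$ be integers with $m\bar m\equiv n\bar n\equiv 1\pmod p$. If $p\equiv 1\pmod{12}$, then \[ a_{pt+bw}=a_{pt+b(w-3b)}=0 \qquad\text{for all } t\in\mathbb{Z}, \] and if $p\equiv 5\pmod{12}$, then \[ a_{pt+bw(1-3b\bar m)}=a_{pt+bw(1-3b\bar n)}=0 \qquad\text{for all } t\in\mathbb{Z}. \]
   Context: For complex $z\neq 0$ and $0<|q|<1$: $(z;q)_\infty=\prod_{j\ge 0}(1-zq^j)$, $(a_1,\dots,a_j;q)_\infty=(a_1;q)_\infty\cdots(a_j;q)_\infty$, and the quintuple product is $Q(z,q)=(z,q/z,q;q)_\infty\,(qz^2,q/z^2;q^2)_\infty$. Equivalently $Q(z,q)=\sum_{k\in\mathbb{Z}}q^{k(3k-1)/2}z^{3k}(1-zq^k)$, so $Q(q^x,q^p)$ for integers $x$ is a Laurent series in $q$ with integer coefficients. *)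

theory Defs
  imports "HOL-Analysis.Analysis" "HOL-Number_Theory.Cong"
    "HOL-Computational_Algebra.Primes"
begin

text \<open>Library infinite products may have finitely many vanishing factors, in which case the
  value is 0; so the definition is also correct for \<open>a = q powi (- j)\<close>.\<close>

definition qpoch_inf :: "complex \<Rightarrow> complex \<Rightarrow> complex" where
  "qpoch_inf a q = (\<Prod>j. 1 - a * q ^ j)"

definition quintuple :: "complex \<Rightarrow> complex \<Rightarrow> complex" where
  "quintuple z q =
     qpoch_inf z q * qpoch_inf (q / z) q * qpoch_inf q q *
     (qpoch_inf (q * z\<^sup>2) (q\<^sup>2) * qpoch_inf (q / z\<^sup>2) (q\<^sup>2))"

end

theory Submission
  imports Defs
begin

text \<open>
  Expanding the infinite products by Euler's identity, \<open>Q(z, q)\<close> is a Laurent series in \<open>z\<close>, and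
  the functional equations \<open>q z\<^sup>3 Q(q z, q) = Q(z, q)\<close> and \<open>z Q(1/z, q) = - Q(z, q)\<close> determine it up
  to a factor \<open>C(q)\<close>: the coefficient of \<open>z\<^sup>N\<close> is \<open>C(q) s(N) q\<^bsup>N(N-1)/6\<^esup>\<close>, where
  \<open>s(N) = 1, -1, 0\<close> for \<open>N \<equiv> 0, 1, 2\<close> modulo 3. Hence the product of the two quintuple products
  is \<open>C(q\<^sup>p)\<^sup>2\<close> times a signed sum of powers of \<open>q\<close> over the points \<open>(M, N)\<close> of the square lattice,
  whose exponent is essentially the squared distance from a fixed centre. For the
  residue classes in question, a reflection in a line through this centre maps the lattice points
  with exponent in the class to each other and reverses all signs, so that their contributions
  cancel. In Gaussian integers, the direction of the reflection is \<open>m + n i\<close> times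
  \<open>i\<close>, \<open>1\<close>, \<open>1 + i\<close>. Residue classes of exponents modulo \<open>p\<close> are singled out by averaging over
  the \<open>p\<close>-th roots of unity, under which \<open>C(q\<^sup>p)\<close> is invariant.
\<close>

subsection \<open>Unconditional sums and residue classes of exponents\<close>

lemma has_sum_diff:
  fixes f g :: "'a \<Rightarrow> 'b :: real_normed_algebra_1"
  assumes "(f has_sum S) A" "(g has_sum T) A"
  shows "((\<lambda>x. f x - g x) has_sum (S - T)) A"
  using has_sum_add[OF assms(1) has_sum_uminusI[OF assms(2)]] by simp

lemma has_sum_sum:
  fixes f :: "'i \<Rightarrow> 'a \<Rightarrow> complex"
  assumes "finite I" "\<And>i. i \<in> I \<Longrightarrow> (f i has_sum S i) A"
  shows "((\<lambda>x. \<Sum>i\<in>I. f i x) has_sum (\<Sum>i\<in>I. S i)) A"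
  using assms
proof (induction I rule: finite_induct)
  case (insert i I)
  then show ?case
    using has_sum_add[of "f i" A "S i"] by simp
qed simp

lemma has_sum_mult_Times:
  fixes f :: "'a \<Rightarrow> complex" and g :: "'b \<Rightarrow> complex"
  assumes f: "(f has_sum S) A" and g: "(g has_sum T) B"
  shows "((\<lambda>(x, y). f x * g y) has_sum S * T) (A \<times> B)"
proof (rule has_sum_SigmaI)
  show "((\<lambda>y. case (x, y) of (x, y) \<Rightarrow> f x * g y) has_sum f x * T) B" for x
    using has_sum_cmult_right[OF g, of "f x"] by simp
  show "((\<lambda>x. f x * T) has_sum S * T) A"
    by (rule has_sum_cmult_left[OF f])
  have nf: "(\<lambda>x. norm (f x)) summable_on A" and ng: "(\<lambda>x. norm (g x)) summable_on B"
    using f g summable_on_iff_abs_summable_on_complex summable_on_def by blast+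
  have "(\<lambda>(x, y). norm (f x) * norm (g y)) summable_on (A \<times> B)"
  proof (rule summable_on_SigmaI)
    show "((\<lambda>y. case (x, y) of (x, y) \<Rightarrow> norm (f x) * norm (g y)) has_sum
            norm (f x) * (\<Sum>\<^sub>\<infinity>y\<in>B. norm (g y))) B" for x
      using has_sum_cmult_right[OF has_sum_infsum[OF ng], of "norm (f x)"] by simp
    show "(\<lambda>x. norm (f x) * (\<Sum>\<^sub>\<infinity>y\<in>B. norm (g y))) summable_on A"
      by (rule summable_on_cmult_left[OF nf])
  qed auto
  then show "(\<lambda>(x, y). f x * g y) summable_on (A \<times> B)"
    by (subst summable_on_iff_abs_summable_on_complex) (simp add: case_prod_unfold norm_mult)
qed

text \<open>Collecting terms of equal exponent turns a sum over any index set into a series indexed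
  by exponents.\<close>

lemma has_sum_fibres:
  fixes g :: "'a \<Rightarrow> complex" and e :: "'a \<Rightarrow> 'b"
  assumes "(g has_sum S) A"
  shows "((\<lambda>y. \<Sum>\<^sub>\<infinity>x\<in>{x \<in> A. e x = y}. g x) has_sum S) UNIV"
proof (rule has_sum_SigmaD)
  have "(g \<circ> snd has_sum S) ((\<lambda>x. (e x, x)) ` A)"
    using assms by (subst has_sum_reindex) (auto simp: inj_on_def o_def)
  also have "(\<lambda>x. (e x, x)) ` A = Sigma UNIV (\<lambda>y. {x \<in> A. e x = y})"
    by auto
  finally show "(g \<circ> snd has_sum S) (Sigma UNIV (\<lambda>y. {x \<in> A. e x = y}))" .
  have "g summable_on A"
    using assms summable_on_def by blast
  then have "g summable_on {x \<in> A. e x = y}" for y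
    by (rule summable_on_subset_banach) auto
  then show "((\<lambda>x. (g \<circ> snd) (y, x)) has_sum (\<Sum>\<^sub>\<infinity>x\<in>{x \<in> A. e x = y}. g x)) {x \<in> A. e x = y}" for y
    by (simp add: o_def)
qed

section \<open>Filtering exponents by roots of unity\<close>

lemma cis_root_powi_eq_1_iff:
  assumes "n > 0"
  shows "cis (2 * pi / real n) powi k = 1 \<longleftrightarrow> int n dvd k"
proof -
  have "cis (2 * pi / real n) powi k = exp (\<i> * of_real (of_int k * (2 * pi / real n)))"
    by (simp only: cis_power_int flip: cis_conv_exp)
  also have "\<dots> = 1 \<longleftrightarrow> (\<exists>j::int. of_int k * (2 * pi / real n) = of_int (2 * j) * pi)"
    by (simp add: exp_eq_1)
  also have "\<dots> \<longleftrightarrow> (\<exists>j::int. real_of_int k = of_int (int n * j))"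
    using assms by (intro ex_cong1) (auto simp: field_simps)
  also have "\<dots> \<longleftrightarrow> int n dvd k"
    by (simp only: of_int_eq_iff dvd_def)
  finally show ?thesis .
qed

lemma sum_cis_root_powi:
  assumes "n > 0"
  shows "(\<Sum>j<n. (cis (2 * pi / real n) ^ j) powi k) = (if int n dvd k then of_nat n else 0)"
proof -
  let ?w = "cis (2 * pi / real n) powi k"
  have eq: "(cis (2 * pi / real n) ^ j) powi k = ?w ^ j" for j
    by (metis power_int_mult power_int_of_nat mult.commute)
  have "?w ^ n = cis (2 * pi / real n) powi (k * int n)"
    by (metis power_int_mult power_int_of_nat)
  then have "?w ^ n = 1"
    using cis_root_powi_eq_1_iff[OF assms, of "k * int n"] by simp
  then show ?thesis
    using geometric_sum[of ?w n] cis_root_powi_eq_1_iff[OF assms, of k] unfolding eq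
    by (cases "int n dvd k") auto
qed

text \<open>Averaging over the \<open>n\<close>-th roots of unity keeps exactly the exponents
  congruent to \<open>r\<close>. The result depends on the series only through the values
  \<open>F j\<close>, so two expansions of one function can be compared class by class.\<close>

lemma has_sum_residue_class:
  fixes g :: "'a \<Rightarrow> complex" and e :: "'a \<Rightarrow> int"
  assumes "n > 0"
    and "\<And>j. j < n \<Longrightarrow> ((\<lambda>x. g x * (cis (2 * pi / real n) ^ j) powi e x) has_sum F j) A"
  shows "((\<lambda>x. if int n dvd e x - r then g x else 0) has_sum
           (\<Sum>j<n. (cis (2 * pi / real n) ^ j) powi (- r) * F j) / of_nat n) A"
proof -
  let ?w = "cis (2 * pi / real n)"
  have "((\<lambda>x. (\<Sum>j<n. (?w ^ j) powi (- r) * (g x * (?w ^ j) powi e x)) * inverse (of_nat n)) has_sum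
          (\<Sum>j<n. (?w ^ j) powi (- r) * F j) * inverse (of_nat n)) A"
    by (intro has_sum_cmult_left has_sum_sum has_sum_cmult_right assms) auto
  moreover have "(\<Sum>j<n. (?w ^ j) powi (- r) * (g x * (?w ^ j) powi e x)) * inverse (of_nat n) =
      (if int n dvd e x - r then g x else 0)" for x
  proof -
    have "(\<Sum>j<n. (?w ^ j) powi (- r) * (g x * (?w ^ j) powi e x)) =
        g x * (\<Sum>j<n. (?w ^ j) powi (e x - r))"
      unfolding sum_distrib_left
      by (intro sum.cong refl) (simp add: power_int_diff power_int_minus field_simps)
    then show ?thesis
      using assms(1) by (simp add: sum_cis_root_powi)
  qed
  ultimately show ?thesis
    by (simp add: divide_inverse)
qed

text \<open>A discrete substitute for Cauchy's integral: the terms with index congruent to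
  \<open>r\<close> modulo \<open>n\<close> sum to 0, and for large \<open>n\<close> they consist of
  \<open>g r\<close> and a tail of norm at most half that of \<open>g r\<close>.\<close>

lemma powi_series_eq_0_imp_coeff_eq_0:
  fixes d :: "int \<Rightarrow> complex"
  assumes \<rho>: "\<rho> > 0"
    and zero: "\<And>z. norm z = \<rho> \<Longrightarrow> ((\<lambda>t. d t * z powi t) has_sum 0) UNIV"
  shows "d r = 0"
proof (rule ccontr)
  assume "d r \<noteq> 0"
  define g where "g t = d t * of_real \<rho> powi t" for t
  have "g r \<noteq> 0"
    using \<open>d r \<noteq> 0\<close> \<rho> by (simp add: g_def)
  have "(g has_sum 0) UNIV"
    using zero[of "of_real \<rho>"] \<rho> by (simp add: g_def[abs_def])
  then have "(\<lambda>t. norm (g t)) summable_on UNIV"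
    using summable_on_iff_abs_summable_on_complex summable_on_def by blast
  then obtain S where S: "((\<lambda>t. norm (g t)) has_sum S) UNIV"
    using summable_on_def by blast
  obtain X where X: "finite X" "dist (\<Sum>t\<in>X. norm (g t)) S \<le> norm (g r) / 2"
    using has_sum_finite_approximation[OF S, of "norm (g r) / 2"] \<open>g r \<noteq> 0\<close> by auto
  \<comment> \<open>for a modulus exceeding all distances from \<open>r\<close> to \<open>X\<close>, the class of \<open>r\<close> meets \<open>X\<close> only in \<open>r\<close>\<close>
  define n where "n = nat (Max (insert 1 ((\<lambda>t. \<bar>t - r\<bar> + 1) ` X)))"
  have n_bound: "\<bar>t - r\<bar> < int n" if "t \<in> X" for t
  proof -
    have "\<bar>t - r\<bar> + 1 \<le> Max (insert 1 ((\<lambda>t. \<bar>t - r\<bar> + 1) ` X))"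
      using X(1) that by (intro Max_ge) auto
    then show ?thesis
      unfolding n_def by linarith
  qed
  have "Max (insert 1 ((\<lambda>t. \<bar>t - r\<bar> + 1) ` X)) \<ge> 1"
    using X(1) by (intro Max_ge) auto
  then have "n > 0"
    by (simp add: n_def)
  have "((\<lambda>t. if int n dvd t - r then g t else 0) has_sum
          (\<Sum>j<n. (cis (2 * pi / real n) ^ j) powi (- r) * 0) / of_nat n) UNIV"
  proof (rule has_sum_residue_class[OF \<open>n > 0\<close>])
    fix j
    have "norm (of_real \<rho> * cis (2 * pi / real n) ^ j) = \<rho>"
      using \<rho> by (simp add: norm_mult norm_power)
    from zero[OF this] show "((\<lambda>t. g t * (cis (2 * pi / real n) ^ j) powi t) has_sum 0) UNIV"
      by (simp add: g_def power_int_mult_distrib mult.assoc)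
  qed
  then have cls: "((\<lambda>t. if int n dvd t - r then g t else 0) has_sum 0) UNIV"
    by simp
  have "((\<lambda>t. if t = r then g r else 0) has_sum g r) {r}"
    by (rule has_sum_finiteI) auto
  then have single: "((\<lambda>t. if t = r then g r else 0) has_sum g r) UNIV"
    by (subst has_sum_cong_neutral[where T = "{r}" and g = "\<lambda>t. if t = r then g r else 0"]) auto
  have "((\<lambda>t. norm (g t)) has_sum (\<Sum>t\<in>insert r X. norm (g t))) (insert r X)"
    using X(1) by (intro has_sum_finiteI) auto
  then have "((\<lambda>t. if t \<in> insert r X then norm (g t) else 0) has_sum
      (\<Sum>t\<in>insert r X. norm (g t))) UNIV"
    by (subst has_sum_cong_neutral[where T = "insert r X" and g = "\<lambda>t. norm (g t)"]) auto
  from has_sum_diff[OF S this]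
  have tail: "((\<lambda>t. norm (g t) - (if t \<in> insert r X then norm (g t) else 0)) has_sum
      S - (\<Sum>t\<in>insert r X. norm (g t))) UNIV" .
  have "norm (0 - g r) \<le> S - (\<Sum>t\<in>insert r X. norm (g t))"
  proof (rule norm_infsum_le[OF has_sum_diff[OF cls single] tail])
    fix t
    have "t = r" if "int n dvd t - r" "t \<in> X"
      using n_bound[OF that(2)] that(1) by (metis dvd_imp_le_int abs_of_nat eq_iff_diff_eq_0 leD)
    then show "norm ((if int n dvd t - r then g t else 0) - (if t = r then g r else 0)) \<le>
        norm (g t) - (if t \<in> insert r X then norm (g t) else 0)"
      by auto
  qed
  also have "(\<Sum>t\<in>X. norm (g t)) \<le> (\<Sum>t\<in>insert r X. norm (g t))"
    using X(1) by (intro sum_mono2) auto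
  then have "S - (\<Sum>t\<in>insert r X. norm (g t)) \<le> norm (g r) / 2"
    using X(2) unfolding dist_real_def by linarith
  finally show False
    using \<open>g r \<noteq> 0\<close> by simp
qed

subsection \<open>Euler's expansion\<close>

text \<open>This is (-1)^k q^(k(k-1)/2) / (q;q)_k, written as a product of ratios of consecutive
  coefficients.\<close>

definition euler_coeff :: "complex \<Rightarrow> nat \<Rightarrow> complex" where
  "euler_coeff q k = (\<Prod>i<k. - (q ^ i) / (1 - q ^ Suc i))"

lemma euler_coeff_0 [simp]: "euler_coeff q 0 = 1"
  by (simp add: euler_coeff_def)

lemma euler_coeff_Suc:
  assumes "norm q < 1"
  shows "euler_coeff q (Suc k) * (1 - q ^ Suc k) = - (q ^ k) * euler_coeff q k"
proof -
  have "norm q ^ Suc k < 1 ^ Suc k"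
    using assms by (intro power_strict_mono) auto
  then have "norm (q ^ Suc k) < 1"
    by (simp only: norm_power power_one)
  then have "1 - q ^ Suc k \<noteq> 0"
    by auto
  then show ?thesis
    unfolding euler_coeff_def prod.lessThan_Suc by (simp add: field_simps)
qed

text \<open>The ratio of consecutive terms has norm at most |q|^k |z| / (1 - |q|), which tends to
  0.\<close>

lemma summable_norm_euler_coeff:
  assumes q: "norm q < 1"
  shows "summable (\<lambda>k. norm (euler_coeff q k * z ^ k))"
proof -
  have "(\<lambda>k. norm q ^ k * (norm z / (1 - norm q))) \<longlonglongrightarrow> 0"
    using q by (intro tendsto_mult_left_zero LIMSEQ_realpow_zero) auto
  then have "eventually (\<lambda>k. norm q ^ k * (norm z / (1 - norm q)) < 1 / 2) sequentially"
    by (rule order_tendstoD) simp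
  then obtain N where N: "norm q ^ k * (norm z / (1 - norm q)) < 1 / 2" if "k \<ge> N" for k
    unfolding eventually_sequentially by blast
  show ?thesis
  proof (rule summable_ratio_test[where c = "1 / 2" and N = N])
    fix k assume "k \<ge> N"
    let ?u = "euler_coeff q k * z ^ k"
    have "norm (q ^ Suc k) \<le> norm q"
      using q by (simp add: norm_power norm_mult mult_left_le power_le_one)
    then have le: "1 - norm q \<le> norm (1 - q ^ Suc k)"
      using norm_triangle_ineq2[of 1 "q ^ Suc k"] by simp
    have "euler_coeff q (Suc k) * z ^ Suc k * (1 - q ^ Suc k) =
        (euler_coeff q (Suc k) * (1 - q ^ Suc k)) * z ^ Suc k"
      by (simp only: mult_ac)
    also have "\<dots> = - (q ^ k) * z * ?u"
      unfolding euler_coeff_Suc[OF q] by simp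
    finally have "euler_coeff q (Suc k) * z ^ Suc k * (1 - q ^ Suc k) = - (q ^ k) * z * ?u" .
    then have "norm (euler_coeff q (Suc k) * z ^ Suc k) * norm (1 - q ^ Suc k) =
        norm q ^ k * norm z * norm ?u"
      unfolding norm_mult[symmetric] norm_power[symmetric] by (metis norm_minus_cancel mult_minus_left)
    then have "norm (euler_coeff q (Suc k) * z ^ Suc k) * (1 - norm q) \<le>
        norm q ^ k * norm z * norm ?u"
      using mult_left_mono[OF le norm_ge_zero[of "euler_coeff q (Suc k) * z ^ Suc k"]] by linarith
    then have "norm (euler_coeff q (Suc k) * z ^ Suc k) \<le>
        (norm q ^ k * (norm z / (1 - norm q))) * norm ?u"
      using q by (simp add: field_simps)
    also have "\<dots> \<le> 1 / 2 * norm ?u"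
      using N[OF \<open>k \<ge> N\<close>] by (intro mult_right_mono) auto
    finally show "norm (norm (euler_coeff q (Suc k) * z ^ Suc k)) \<le> 1 / 2 * norm (norm ?u)"
      by simp
  qed simp
qed

lemma convergent_prod_qpoch:
  fixes z q :: complex
  assumes "norm q < 1"
  shows "convergent_prod (\<lambda>j. 1 - z * q ^ j)"
proof -
  have "summable (\<lambda>j. norm (1 - z * q ^ j - 1))"
    using assms by (simp add: norm_mult norm_power summable_mult summable_geometric)
  then show ?thesis
    by (intro abs_convergent_prod_imp_convergent_prod summable_imp_abs_convergent_prod)
qed

lemma qpoch_inf_rec:
  assumes "norm q < 1"
  shows "qpoch_inf z q = (1 - z) * qpoch_inf (z * q) q"
  using has_prod_unique[OF has_prod_ignore_initial_segment'[OF convergent_prod_qpoch[OF assms], of z 1]]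
  by (simp add: qpoch_inf_def mult.assoc)

text \<open>The series satisfies f(z) = (1 - z) f(z q), like the product. Iteration splits off the
  partial products and pushes the argument to 0, where the series is continuous with value
  1.\<close>

lemma qpoch_inf_has_sum:
  assumes q: "norm q < 1"
  shows "((\<lambda>k. euler_coeff q k * z ^ k) has_sum qpoch_inf z q) UNIV"
proof -
  define f where "f z = (\<Sum>k. euler_coeff q k * z ^ k)" for z
  have sm: "summable (\<lambda>k. euler_coeff q k * z ^ k)" for z
    using summable_norm_euler_coeff[OF q] by (rule summable_norm_cancel)
  have step: "f z = (1 - z) * f (z * q)" for z
  proof -
    have "(\<lambda>k. euler_coeff q k * (z * q) ^ k) sums f (z * q)"
      unfolding f_def by (rule summable_sums[OF sm])
    moreover from sums_mult[OF this, of "- z"]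
    have "(\<lambda>k. case k of 0 \<Rightarrow> 0 | Suc k \<Rightarrow> - z * (euler_coeff q k * (z * q) ^ k)) sums (- z * f (z * q))"
      using sums_Suc[where f = "\<lambda>k. case k of 0 \<Rightarrow> 0 | Suc k \<Rightarrow> - z * (euler_coeff q k * (z * q) ^ k)"]
      by simp
    ultimately have "(\<lambda>k. euler_coeff q k * (z * q) ^ k +
        (case k of 0 \<Rightarrow> 0 | Suc k \<Rightarrow> - z * (euler_coeff q k * (z * q) ^ k))) sums
        (f (z * q) + - z * f (z * q))"
      by (rule sums_add)
    also have "(\<lambda>k. euler_coeff q k * (z * q) ^ k +
        (case k of 0 \<Rightarrow> 0 | Suc k \<Rightarrow> - z * (euler_coeff q k * (z * q) ^ k))) =
        (\<lambda>k. euler_coeff q k * z ^ k)"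
    proof
      fix k
      show "euler_coeff q k * (z * q) ^ k +
        (case k of 0 \<Rightarrow> 0 | Suc k \<Rightarrow> - z * (euler_coeff q k * (z * q) ^ k)) = euler_coeff q k * z ^ k"
      proof (cases k)
        case (Suc l)
        have "euler_coeff q (Suc l) * (z * q) ^ Suc l + - z * (euler_coeff q l * (z * q) ^ l) =
            z ^ Suc l * (euler_coeff q (Suc l) * q ^ Suc l + - (q ^ l) * euler_coeff q l)"
          by (simp add: power_mult_distrib algebra_simps)
        also have "\<dots> = z ^ Suc l * euler_coeff q (Suc l)"
          unfolding euler_coeff_Suc[OF q, symmetric] by (simp add: algebra_simps)
        finally show ?thesis
          by (simp add: Suc mult_ac)
      qed simp
    qed
    finally show ?thesis
      unfolding f_def[of z] by (simp add: sums_iff algebra_simps)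
  qed
  have iter: "f z = (\<Prod>j<n. 1 - z * q ^ j) * f (z * q ^ n)" for n
  proof (induction n)
    case (Suc n)
    then show ?case
      by (simp only: step[of "z * q ^ n"] prod.lessThan_Suc power_Suc2 mult.assoc)
  qed simp
  have "isCont f 0"
    unfolding f_def by (rule isCont_powser[where K = 1]) (use sm[of 1] in simp_all)
  moreover have "(\<lambda>n. z * q ^ n) \<longlonglongrightarrow> 0"
    using q by (intro tendsto_mult_right_zero LIMSEQ_power_zero)
  ultimately have "(\<lambda>n. f (z * q ^ n)) \<longlonglongrightarrow> f 0"
    by (rule isCont_tendsto_compose)
  moreover have "f 0 = 1"
    unfolding f_def by (subst powser_zero) simp
  ultimately have lim_f: "(\<lambda>n. f (z * q ^ n)) \<longlonglongrightarrow> 1"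
    by simp
  have "(\<lambda>n. \<Prod>j\<le>n. 1 - z * q ^ j) \<longlonglongrightarrow> qpoch_inf z q"
    unfolding qpoch_inf_def by (rule convergent_prod_LIMSEQ[OF convergent_prod_qpoch[OF q]])
  then have "(\<lambda>n. \<Prod>j<n. 1 - z * q ^ j) \<longlonglongrightarrow> qpoch_inf z q"
    by (subst filterlim_sequentially_Suc[symmetric]) (simp add: lessThan_Suc_atMost)
  from tendsto_mult[OF this lim_f] have "(\<lambda>n. f z) \<longlonglongrightarrow> qpoch_inf z q"
    unfolding iter[symmetric] by simp
  then have "f z = qpoch_inf z q"
    by (simp add: LIMSEQ_const_iff)
  then show ?thesis
    using summable_norm_euler_coeff[OF q] summable_sums[OF sm[of z]] unfolding f_def
    by (intro norm_summable_imp_has_sum) auto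
qed

subsection \<open>The quintuple product as a Laurent series\<close>

text \<open>Only the existence of coefficients common to all \<open>z\<close> is recorded; the
  functional equations determine them later.\<close>

definition laurent_expandable :: "(complex \<Rightarrow> complex) \<Rightarrow> bool" where
  "laurent_expandable f \<longleftrightarrow>
     (\<exists>c. \<forall>z. z \<noteq> 0 \<longrightarrow> ((\<lambda>N::int. c N * z powi N) has_sum f z) UNIV)"

lemma laurent_expandableI:
  fixes e :: "'a \<Rightarrow> int"
  assumes "\<And>z. z \<noteq> 0 \<Longrightarrow> ((\<lambda>x. g x * z powi e x) has_sum f z) A"
  shows "laurent_expandable f"
  unfolding laurent_expandable_def
proof (intro exI allI impI)
  fix z :: complex assume "z \<noteq> 0"
  have "(\<Sum>\<^sub>\<infinity>x\<in>{x \<in> A. e x = N}. g x * z powi e x) = (\<Sum>\<^sub>\<infinity>x\<in>{x \<in> A. e x = N}. g x) * z powi N" for N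
    by (subst infsum_cmult_left'[symmetric]) (auto intro!: infsum_cong)
  then show "((\<lambda>N. (\<Sum>\<^sub>\<infinity>x\<in>{x \<in> A. e x = N}. g x) * z powi N) has_sum f z) UNIV"
    using has_sum_fibres[OF assms[OF \<open>z \<noteq> 0\<close>], of e] by simp
qed

lemma laurent_expandable_mult:
  assumes "laurent_expandable f" "laurent_expandable g"
  shows "laurent_expandable (\<lambda>z. f z * g z)"
proof -
  obtain c d where c: "\<And>z. z \<noteq> 0 \<Longrightarrow> ((\<lambda>N::int. c N * z powi N) has_sum f z) UNIV"
    and d: "\<And>z. z \<noteq> 0 \<Longrightarrow> ((\<lambda>N::int. d N * z powi N) has_sum g z) UNIV"
    using assms unfolding laurent_expandable_def by blast
  show ?thesis
  proof (rule laurent_expandableI[where A = "UNIV \<times> UNIV" and g = "\<lambda>(M, N). c M * d N"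
        and e = "\<lambda>(M, N). M + N"])
    fix z :: complex assume "z \<noteq> 0"
    then show "((\<lambda>x. (case x of (M, N) \<Rightarrow> c M * d N) * z powi (case x of (M, N) \<Rightarrow> M + N)) has_sum
        f z * g z) (UNIV \<times> UNIV)"
      using has_sum_mult_Times[OF c d, of z z]
      by (simp add: case_prod_unfold power_int_add mult_ac)
  qed
qed

lemma laurent_expandable_qpoch_inf:
  assumes "norm q < 1"
  shows "laurent_expandable (\<lambda>z. qpoch_inf (a * z powi s) q)"
proof (rule laurent_expandableI)
  fix z :: complex assume "z \<noteq> 0"
  have "euler_coeff q k * (a * z powi s) ^ k = euler_coeff q k * a ^ k * z powi (s * int k)" for k
    by (simp add: power_mult_distrib power_int_mult)
  then show "((\<lambda>k. euler_coeff q k * a ^ k * z powi (s * int k)) has_sum qpoch_inf (a * z powi s) q) UNIV"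
    using qpoch_inf_has_sum[OF assms, of "a * z powi s"] by (simp only:)
qed

lemma laurent_expandable_quintuple:
  assumes "norm q < 1"
  shows "laurent_expandable (\<lambda>z. quintuple z q)"
proof -
  have q2: "norm (q\<^sup>2) < 1"
    using assms by (simp add: norm_power power_less_one_iff)
  \<comment> \<open>The constant factor \<open>qpoch_inf q q\<close> enters with exponent 0, so one
    lemma covers all five factors.\<close>
  have "laurent_expandable (\<lambda>z. qpoch_inf (1 * z powi 1) q * qpoch_inf (q * z powi (-1)) q *
      qpoch_inf (q * z powi 0) q * (qpoch_inf (q * z powi 2) (q\<^sup>2) * qpoch_inf (q * z powi (-2)) (q\<^sup>2)))"
    by (intro laurent_expandable_mult laurent_expandable_qpoch_inf assms q2)
  then show ?thesis
    by (simp add: quintuple_def power_int_minus divide_inverse)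
qed

text \<open>The substitution adds or removes the leading factor of each of the four products
  involving \<open>z\<close>; an identity between these four factors remains.\<close>

lemma quintuple_mult_q:
  assumes q: "norm q < 1" "q \<noteq> 0" and z: "z \<noteq> 0"
  shows "quintuple (z * q) q * (q * z ^ 3) = quintuple z q"
proof -
  have q2: "norm (q\<^sup>2) < 1"
    using q by (simp add: norm_power power_less_one_iff)
  define A B C D where "A = qpoch_inf (z * q) q" and "B = qpoch_inf (q / z) q"
    and "C = qpoch_inf (q * z\<^sup>2 * q\<^sup>2) (q\<^sup>2)" and "D = qpoch_inf (q / z\<^sup>2) (q\<^sup>2)"
  have 1: "qpoch_inf z q = (1 - z) * A"
    unfolding A_def by (rule qpoch_inf_rec[OF q(1)])
  have 2: "qpoch_inf (1 / z) q = (1 - 1 / z) * B"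
    unfolding B_def using qpoch_inf_rec[OF q(1), of "1 / z"] by simp
  have 3: "qpoch_inf (q * z\<^sup>2) (q\<^sup>2) = (1 - q * z\<^sup>2) * C"
    unfolding C_def by (rule qpoch_inf_rec[OF q2])
  have "1 / (q * z\<^sup>2) * q\<^sup>2 = q / z\<^sup>2"
    using q(2) by (simp add: power2_eq_square)
  then have 4: "qpoch_inf (1 / (q * z\<^sup>2)) (q\<^sup>2) = (1 - 1 / (q * z\<^sup>2)) * D"
    unfolding D_def using qpoch_inf_rec[OF q2, of "1 / (q * z\<^sup>2)"] by simp
  have "q / (z * q) = 1 / z" "q * (z * q)\<^sup>2 = q * z\<^sup>2 * q\<^sup>2" "q / (z * q)\<^sup>2 = 1 / (q * z\<^sup>2)"
    using q(2) by (simp_all add: power2_eq_square)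
  then have "quintuple (z * q) q =
      A * ((1 - 1 / z) * B) * qpoch_inf q q * (C * ((1 - 1 / (q * z\<^sup>2)) * D))"
    unfolding quintuple_def by (simp only: 2 4 A_def C_def)
  moreover have "quintuple z q = (1 - z) * A * B * qpoch_inf q q * ((1 - q * z\<^sup>2) * C * D)"
    unfolding quintuple_def 1 3 by (simp only: B_def D_def)
  moreover have "(1 - 1 / z) * (1 - 1 / (q * z\<^sup>2)) * (q * z ^ 3) = (1 - z) * (1 - q * z\<^sup>2)"
    using q(2) z by (simp add: field_simps power2_eq_square power3_eq_cube)
  ultimately show ?thesis
    by algebra
qed

text \<open>The products at q z^2 and q / z^2 are exchanged, and so are those at z and q / z up to
  leading factors, where (1 - 1/z) z = -(1 - z).\<close>

lemma quintuple_inverse: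
  assumes q: "norm q < 1" and z: "z \<noteq> 0"
  shows "quintuple (inverse z) q * z = - quintuple z q"
proof -
  have "qpoch_inf z q = (1 - z) * qpoch_inf (q * z) q"
    using qpoch_inf_rec[OF q, of z] by (simp add: mult.commute)
  moreover have "qpoch_inf (inverse z) q * z = (z - 1) * qpoch_inf (q / z) q"
    using qpoch_inf_rec[OF q, of "inverse z"] z by (simp add: field_simps)
  moreover have "q / inverse z = q * z" "q * (inverse z)\<^sup>2 = q / z\<^sup>2" "q / (inverse z)\<^sup>2 = q * z\<^sup>2"
    by (simp_all add: field_simps)
  ultimately show ?thesis
    unfolding quintuple_def by (simp only:) algebra
qed

section \<open>Coefficients of the quintuple product\<close>

definition quint_sign :: "int \<Rightarrow> int" where
  "quint_sign N = (if 3 dvd N then 1 else if 3 dvd N - 1 then - 1 else 0)"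

text \<open>On N = 3k and N = 3k + 1 this gives the exponents k(3k - 1)/2 and k(3k + 1)/2 of the
  classical expansion. On N = 3k + 2 the division rounds, but \<open>quint_sign\<close> vanishes
  there.\<close>

definition quint_exp :: "int \<Rightarrow> int" where
  "quint_exp N = N * (N - 1) div 6"

lemma quint_exp_shift: "quint_exp N = quint_exp (N - 3) + (N - 2)"
proof -
  have "N * (N - 1) = (N - 3) * (N - 3 - 1) + (N - 2) * 6"
    by algebra
  then show ?thesis
    by (simp only: quint_exp_def div_mult_self1)
qed

lemma quint_sign_shift: "quint_sign (N - 3) = quint_sign N"
  unfolding quint_sign_def by presburger

text \<open>The value of the constant (it is 1) is never needed: evaluated at \<open>q ^ p\<close>, it does not
  interact with residue classes of exponents modulo \<open>p\<close>.\<close>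

lemma quintuple_has_sum:
  assumes q: "norm q < 1" "q \<noteq> 0"
  obtains C where "\<And>z. z \<noteq> 0 \<Longrightarrow>
    ((\<lambda>N. C * (of_int (quint_sign N) * q powi quint_exp N * z powi N)) has_sum quintuple z q) UNIV"
proof -
  obtain c where c: "\<And>z. z \<noteq> 0 \<Longrightarrow> ((\<lambda>N. c N * z powi N) has_sum quintuple z q) UNIV"
    using laurent_expandable_quintuple[OF q(1)] unfolding laurent_expandable_def by blast
  \<comment> \<open>\<open>rec\<close> and \<open>sym\<close> compare coefficients in the two
    functional equations, on the unit circle.\<close>
  have rec: "c N = c (N - 3) * q powi (N - 2)" for N
  proof -
    have "c N - c (N - 3) * q powi (N - 2) = 0"
    proof (rule powi_series_eq_0_imp_coeff_eq_0[of 1 "\<lambda>N. c N - c (N - 3) * q powi (N - 2)"])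
      fix z :: complex assume "norm z = 1"
      then have z: "z \<noteq> 0" by auto
      have "((\<lambda>N. c N * (z * q) powi N * (q * z ^ 3)) has_sum quintuple (z * q) q * (q * z ^ 3)) UNIV"
        using z q by (intro has_sum_cmult_left c) auto
      then have "((\<lambda>N. c (N - 3) * (z * q) powi (N - 3) * (q * z ^ 3)) has_sum quintuple z q) UNIV"
        unfolding quintuple_mult_q[OF q z]
        by (subst has_sum_reindex_bij_witness[where j = "\<lambda>N. N - 3" and i = "\<lambda>N. N + 3" and T = UNIV
              and h = "\<lambda>N. c N * (z * q) powi N * (q * z ^ 3)"]) auto
      moreover have "c (N - 3) * (z * q) powi (N - 3) * (q * z ^ 3) =
          c (N - 3) * q powi (N - 2) * z powi N" for N
      proof -
        have "z powi N = z powi (N - 3) * z ^ 3"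
          using power_int_add[of z "N - 3" 3] z by simp
        moreover have "q powi (N - 2) = q powi (N - 3) * q"
          using power_int_add[of q "N - 3" 1] q by simp
        ultimately show ?thesis
          by (simp add: power_int_mult_distrib mult_ac)
      qed
      ultimately have "((\<lambda>N. c (N - 3) * q powi (N - 2) * z powi N) has_sum quintuple z q) UNIV"
        by simp
      from has_sum_diff[OF c[OF z] this]
      show "((\<lambda>N. (c N - c (N - 3) * q powi (N - 2)) * z powi N) has_sum 0) UNIV"
        by (simp add: left_diff_distrib)
    qed simp
    then show ?thesis
      by simp
  qed
  have sym: "c (1 - N) = - c N" for N
  proof -
    have "c N + c (1 - N) = 0"
    proof (rule powi_series_eq_0_imp_coeff_eq_0[of 1 "\<lambda>N. c N + c (1 - N)"])
      fix z :: complex assume "norm z = 1"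
      then have z: "z \<noteq> 0" by auto
      have "((\<lambda>N. c N * (inverse z) powi N * z) has_sum quintuple (inverse z) q * z) UNIV"
        using z by (intro has_sum_cmult_left c) auto
      then have "((\<lambda>N. c (1 - N) * (inverse z) powi (1 - N) * z) has_sum - quintuple z q) UNIV"
        unfolding quintuple_inverse[OF q(1) z]
        by (subst has_sum_reindex_bij_witness[where j = "\<lambda>N. 1 - N" and i = "\<lambda>N. 1 - N" and T = UNIV
              and h = "\<lambda>N. c N * (inverse z) powi N * z"]) auto
      moreover have "c (1 - N) * (inverse z) powi (1 - N) * z = c (1 - N) * z powi N" for N
        using z by (simp add: power_int_diff power_int_inverse field_simps)
      ultimately have "((\<lambda>N. c (1 - N) * z powi N) has_sum - quintuple z q) UNIV"
        by simp
      from has_sum_add[OF c[OF z] this]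
      show "((\<lambda>N. (c N + c (1 - N)) * z powi N) has_sum 0) UNIV"
        by (simp add: distrib_right)
    qed simp
    then show ?thesis
      by (simp add: eq_neg_iff_add_eq_0 add.commute)
  qed
  \<comment> \<open>The deviation from the claimed coefficients with constant \<open>c 0\<close>. It
    obeys the same recurrence of step 3, so its vanishing at 0, 1 and 2 suffices.\<close>
  define d where "d N = c N - c 0 * (of_int (quint_sign N) * q powi quint_exp N)" for N
  have d_rec: "d N = d (N - 3) * q powi (N - 2)" for N
  proof -
    have "q powi quint_exp N = q powi quint_exp (N - 3) * q powi (N - 2)"
      using q(2) by (simp add: quint_exp_shift[of N] power_int_add)
    then show ?thesis
      by (simp add: d_def rec[of N] quint_sign_shift algebra_simps)
  qed
  have propagate: "d (r + 3 * k) = 0" if "d r = 0" for r k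
  proof (induction k rule: int_induct[where k = 0])
    case (step1 k)
    then show ?case
      using d_rec[of "r + 3 * (k + 1)"] by (simp add: algebra_simps)
  next
    case (step2 k)
    then show ?case
      using d_rec[of "r + 3 * k"] q(2) by (simp add: algebra_simps)
  qed (use that in simp)
  have "d 0 = 0"
    by (simp add: d_def quint_sign_def quint_exp_def)
  moreover have "d 1 = 0"
    using sym[of 0] by (simp add: d_def quint_sign_def quint_exp_def)
  \<comment> \<open>The symmetry gives \<open>c (-1) = - c 2\<close>, and the recurrence, with
    \<open>q powi 0\<close>, gives \<open>c 2 = c (-1)\<close>; hence
    \<open>c 2 = 0\<close>.\<close>
  moreover have "d 2 = 0"
    using sym[of 2] rec[of 2] by (simp add: d_def quint_sign_def quint_exp_def)
  moreover have "N mod 3 = 0 \<or> N mod 3 = 1 \<or> N mod 3 = 2" for N :: int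
    by presburger
  ultimately have d0: "d N = 0" for N
    using propagate[of "N mod 3" "N div 3"] by (metis mod_mult_div_eq)
  have "c N * z powi N = c 0 * (of_int (quint_sign N) * q powi quint_exp N * z powi N)" for N z
  proof -
    have "c N = c 0 * (of_int (quint_sign N) * q powi quint_exp N)"
      using d0[of N] unfolding d_def by (simp only: right_minus_eq)
    then show ?thesis
      by (metis mult.assoc)
  qed
  with c have "((\<lambda>N. c 0 * (of_int (quint_sign N) * q powi quint_exp N * z powi N)) has_sum quintuple z q) UNIV"
    if "z \<noteq> 0" for z
    using that by (simp only: not_False_eq_True)
  then show ?thesis
    by (rule that)
qed

subsection \<open>Reflections of the exponent lattice\<close>

lemma quint_exp_times_6:
  assumes "quint_sign N \<noteq> 0"
  shows "6 * quint_exp N = N * (N - 1)"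
proof -
  have "3 dvd N \<or> 3 dvd N - 1"
    using assms unfolding quint_sign_def by presburger
  then have "3 dvd N * (N - 1)"
    by auto
  moreover have "2 dvd N * (N - 1)"
    by simp
  moreover have "6 dvd x" if "3 dvd x" "2 dvd x" for x :: int
    using that by presburger
  ultimately have "6 dvd N * (N - 1)"
    by blast
  then show ?thesis
    by (simp add: quint_exp_def)
qed

lemma quint_sign_cong: "3 dvd N' - N \<Longrightarrow> quint_sign N' = quint_sign N"
  unfolding quint_sign_def by presburger

text \<open>Modulo 3, the map N -> 1 - N exchanges the classes 0 and 1 and fixes 2, where the sign
  is 0.\<close>

lemma quint_sign_reflect: "3 dvd N' + N - 1 \<Longrightarrow> quint_sign N' = - quint_sign N"
  unfolding quint_sign_def by presburger

text \<open>Where the signs do not vanish, this exponent is, up to the factor \<open>p / 6\<close> and an additive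
  constant, the squared distance of \<open>(M, N)\<close> from \<open>(1/2 - 3 b m / p, 1/2 - 3 b n / p)\<close>.\<close>

definition pair_exp :: "nat \<Rightarrow> int \<Rightarrow> int \<Rightarrow> int \<Rightarrow> int \<times> int \<Rightarrow> int" where
  "pair_exp p b m n = (\<lambda>(M, N). int p * (quint_exp M + quint_exp N) + b * (m * M + n * N))"

definition pair_sign :: "int \<times> int \<Rightarrow> int" where
  "pair_sign = (\<lambda>(M, N). quint_sign M * quint_sign N)"

text \<open>The constant is determined by q^p, so one \<open>C\<close> serves all rotations
  \<open>y\<close> of \<open>q\<close> by \<open>p\<close>-th roots of unity.\<close>

lemma quintuple_prod_has_sum:
  assumes "norm (q ^ p) < 1" "q \<noteq> 0"
  obtains C where "\<And>y. y \<noteq> 0 \<Longrightarrow> y ^ p = q ^ p \<Longrightarrow>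
    ((\<lambda>x. C * (of_int (pair_sign x) * y powi pair_exp p b m n x)) has_sum
      quintuple (y powi (b * m)) (y ^ p) * quintuple (y powi (b * n)) (y ^ p)) UNIV"
proof -
  have "q ^ p \<noteq> 0"
    using assms(2) by simp
  then obtain C where C: "\<And>z. z \<noteq> 0 \<Longrightarrow>
      ((\<lambda>N. C * (of_int (quint_sign N) * (q ^ p) powi quint_exp N * z powi N)) has_sum
        quintuple z (q ^ p)) UNIV"
    using quintuple_has_sum[OF assms(1)] by blast
  have "((\<lambda>x. C\<^sup>2 * (of_int (pair_sign x) * y powi pair_exp p b m n x)) has_sum
      quintuple (y powi (b * m)) (y ^ p) * quintuple (y powi (b * n)) (y ^ p)) UNIV"
    if y: "y \<noteq> 0" "y ^ p = q ^ p" for y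
  proof -
    have term_eq: "C * (of_int (quint_sign M) * (q ^ p) powi quint_exp M * (y powi (b * m)) powi M) *
       (C * (of_int (quint_sign N) * (q ^ p) powi quint_exp N * (y powi (b * n)) powi N)) =
       C\<^sup>2 * (of_int (pair_sign (M, N)) * y powi pair_exp p b m n (M, N))" for M N
    proof -
      have "y powi pair_exp p b m n (M, N) = (y ^ p) powi quint_exp M * (y ^ p) powi quint_exp N *
          ((y powi (b * m)) powi M * (y powi (b * n)) powi N)"
        using y(1) by (simp add: pair_exp_def distrib_left power_int_add power_int_mult mult.assoc)
      then show ?thesis
        by (simp add: y(2) pair_sign_def power2_eq_square mult_ac)
    qed
    have "((\<lambda>(M, N). C * (of_int (quint_sign M) * (q ^ p) powi quint_exp M * (y powi (b * m)) powi M) *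
       (C * (of_int (quint_sign N) * (q ^ p) powi quint_exp N * (y powi (b * n)) powi N))) has_sum
        quintuple (y powi (b * m)) (q ^ p) * quintuple (y powi (b * n)) (q ^ p)) (UNIV \<times> UNIV)"
      using y(1) by (intro has_sum_mult_Times C) auto
    then show ?thesis
      unfolding term_eq by (simp add: y(2) case_prod_unfold)
  qed
  then show ?thesis
    using that by blast
qed

text \<open>The same average over roots of unity restricts the expansion over \<open>t\<close> and
  the one over the lattice to the class of \<open>r\<close>, so both restricted sums agree. On the
  lattice side \<open>\<sigma>\<close> pairs terms of opposite sign, so the common value is
  0.\<close>

lemma coeff_eq_0_if_sign_reversing:
  fixes a :: "int \<Rightarrow> int"
  assumes p: "p > 0"
    and a: "\<And>q :: complex. 0 < norm q \<Longrightarrow> norm q < 1 \<Longrightarrow>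
           ((\<lambda>t. of_int (a t) * q powi t) has_sum
              (quintuple (q powi (b * m)) (q ^ p) * quintuple (q powi (b * n)) (q ^ p))) UNIV"
    and \<sigma>: "\<And>x. pair_sign x \<noteq> 0 \<Longrightarrow> int p dvd pair_exp p b m n x - r \<Longrightarrow>
           pair_sign (\<sigma> x) = - pair_sign x \<and> pair_exp p b m n (\<sigma> x) = pair_exp p b m n x \<and> \<sigma> (\<sigma> x) = x"
  shows "a (int p * t + r) = 0"
proof -
  let ?E = "pair_exp p b m n"
  let ?w = "cis (2 * pi / real p)"
  define Q where
    "Q q = quintuple (q powi (b * m)) (q ^ p) * quintuple (q powi (b * n)) (q ^ p)" for q
  have "((\<lambda>t. (if int p dvd t - r then of_int (a t) else 0) * q powi t) has_sum 0) UNIV"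
    if "norm q = 1 / 2" for q :: complex
  proof -
    have q: "q \<noteq> 0" "norm (q ^ p) < 1"
      using that p by (auto simp: norm_power power_less_one_iff)
    have norm_wq: "norm (q * ?w ^ j) = 1 / 2" for j
      using that by (simp add: norm_mult norm_power)
    have wq: "(q * ?w ^ j) ^ p = q ^ p" for j
    proof -
      have "(?w ^ j) ^ p = (?w ^ p) ^ j"
        by (metis power_mult mult.commute)
      also have "?w ^ p = 1"
        using cis_root_powi_eq_1_iff[OF p, of "int p"] by simp
      finally show ?thesis
        by (simp add: power_mult_distrib)
    qed
    obtain C where C: "\<And>y. y \<noteq> 0 \<Longrightarrow> y ^ p = q ^ p \<Longrightarrow>
        ((\<lambda>x. C * (of_int (pair_sign x) * y powi ?E x)) has_sum Q y) UNIV"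
      using quintuple_prod_has_sum[OF q(2) q(1), of b m n] unfolding Q_def by blast
    define h where "h x = C * (of_int (pair_sign x) * q powi ?E x)" for x
    define V where "V = (\<Sum>j<p. (?w ^ j) powi (- r) * Q (q * ?w ^ j)) / of_nat p"
    have h_cls: "((\<lambda>x. if int p dvd ?E x - r then h x else 0) has_sum V) UNIV"
      unfolding V_def
    proof (rule has_sum_residue_class[OF p])
      fix j
      show "((\<lambda>x. h x * (?w ^ j) powi ?E x) has_sum Q (q * ?w ^ j)) UNIV"
        using C[of "q * ?w ^ j"] q(1) wq by (simp add: h_def power_int_mult_distrib mult_ac)
    qed
    have a_cls: "((\<lambda>t. if int p dvd t - r then of_int (a t) * q powi t else 0) has_sum V) UNIV"
      unfolding V_def
    proof (rule has_sum_residue_class[OF p])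
      fix j
      show "((\<lambda>t. of_int (a t) * q powi t * (?w ^ j) powi t) has_sum Q (q * ?w ^ j)) UNIV"
        using a[of "q * ?w ^ j"] norm_wq[of j] q(1) by (simp add: Q_def power_int_mult_distrib mult_ac)
    qed
    \<comment> \<open>\<open>\<sigma>\<close> maps \<open>S\<close> to itself, since it preserves
      the exponent and keeps the sign nonzero; so it can reindex the sum.\<close>
    define S where "S = {x. pair_sign x \<noteq> 0 \<and> int p dvd ?E x - r}"
    have "(h has_sum V) S"
      using h_cls by (subst (asm) has_sum_cong_neutral[where T = S and g = h]) (auto simp: S_def h_def)
    moreover from this have "((\<lambda>x. - h x) has_sum V) S"
      by (subst has_sum_reindex_bij_witness[where j = \<sigma> and i = \<sigma> and T = S and h = h])
        (use \<sigma> in \<open>auto simp: S_def h_def\<close>)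
    then have "(h has_sum - V) S"
      using has_sum_uminusI by fastforce
    ultimately have "V = - V"
      by (rule has_sum_unique)
    then have "V = 0"
      by simp
    with a_cls show ?thesis
      by (simp add: if_distrib[of "\<lambda>x. x * _"] cong: if_cong)
  qed
  from powi_series_eq_0_imp_coeff_eq_0[where \<rho> = "1 / 2" and r = "int p * t + r", OF _ this] show ?thesis
    by simp
qed

text \<open>The reflection along the direction \<open>(\<alpha>, \<beta>)\<close> that fixes the centre of \<^const>\<open>pair_exp\<close>.
  Modulo 3 it negates exactly one of \<open>2 M - 1\<close> and \<open>2 N - 1\<close>.\<close>

lemma coeff_eq_0_if_reflection:
  fixes a :: "int \<Rightarrow> int"
  assumes p: "p > 0" and p3: "\<not> 3 dvd int p"
    and a: "\<And>q :: complex. 0 < norm q \<Longrightarrow> norm q < 1 \<Longrightarrow>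
           ((\<lambda>t. of_int (a t) * q powi t) has_sum
              (quintuple (q powi (b * m)) (q ^ p) * quintuple (q powi (b * n)) (q ^ p))) UNIV"
    and one: "3 dvd \<alpha> \<longleftrightarrow> \<not> 3 dvd \<beta>"
    and dv: "\<And>M N. int p dvd b * (m * M + n * N) - r \<Longrightarrow>
           int p * (\<alpha>\<^sup>2 + \<beta>\<^sup>2) dvd
             int p * (\<alpha> * (2 * M - 1) + \<beta> * (2 * N - 1)) + 6 * b * (m * \<alpha> + n * \<beta>)"
  shows "a (int p * t + r) = 0"
proof -
  define D where "D = int p * (\<alpha>\<^sup>2 + \<beta>\<^sup>2)"
  define T where "T M N = int p * (\<alpha> * (2 * M - 1) + \<beta> * (2 * N - 1)) + 6 * b * (m * \<alpha> + n * \<beta>)" for M N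
  \<comment> \<open>\<open>T M N\<close> is 2 p times the inner product of (\<alpha>, \<beta>) with
    the vector from the centre to (M, N). So \<open>k M N\<close> is twice the coefficient of the
    orthogonal projection, and \<open>dv\<close> makes it an exact quotient on the residue
    class.\<close>
  define k where "k M N = T M N div D" for M N
  define \<sigma> where "\<sigma> = (\<lambda>(M, N). (M - \<alpha> * k M N, N - \<beta> * k M N))"
  have "\<alpha> \<noteq> 0 \<or> \<beta> \<noteq> 0"
    using one by auto
  then have "D \<noteq> 0"
    using p by (simp add: D_def sum_power2_eq_zero_iff)
  have "pair_sign (\<sigma> x) = - pair_sign x \<and> pair_exp p b m n (\<sigma> x) = pair_exp p b m n x \<and> \<sigma> (\<sigma> x) = x"
    if x: "pair_sign x \<noteq> 0" "int p dvd pair_exp p b m n x - r" for x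
  proof -
    obtain M N where MN: "x = (M, N)"
      by force
    define M' N' where "M' = M - \<alpha> * k M N" and "N' = N - \<beta> * k M N"
    have \<sigma>x: "\<sigma> x = (M', N')"
      by (simp add: \<sigma>_def MN M'_def N'_def)
    have "pair_exp p b m n x - r = int p * (quint_exp M + quint_exp N) + (b * (m * M + n * N) - r)"
      by (simp add: pair_exp_def MN)
    then have "int p dvd b * (m * M + n * N) - r"
      using x(2) by (metis dvd_add_right_iff dvd_triv_left)
    then have "D dvd T M N"
      unfolding D_def T_def by (rule dv)
    then have k: "D * k M N = T M N"
      by (simp add: k_def)
    have "T M' N' = - T M N"
      using k unfolding D_def T_def M'_def N'_def by algebra
    then have "k M' N' = - k M N"
      using \<open>D dvd T M N\<close> by (simp add: k_def dvd_neg_div)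
    then have "\<sigma> (\<sigma> x) = x"
      unfolding \<sigma>x by (simp add: \<sigma>_def MN M'_def N'_def)
    \<comment> \<open>In \<open>D * k M N = T M N\<close> the term with factor 6 vanishes modulo 3,
      and then \<open>p\<close> can be cancelled.\<close>
    have "3 dvd int p * ((\<alpha>\<^sup>2 + \<beta>\<^sup>2) * k M N - (\<alpha> * (2 * M - 1) + \<beta> * (2 * N - 1)))"
    proof -
      have "int p * ((\<alpha>\<^sup>2 + \<beta>\<^sup>2) * k M N - (\<alpha> * (2 * M - 1) + \<beta> * (2 * N - 1))) =
          3 * (2 * b * (m * \<alpha> + n * \<beta>))"
        using k unfolding D_def T_def by algebra
      then show ?thesis
        by (metis dvd_triv_left)
    qed
    then have k3: "3 dvd (\<alpha>\<^sup>2 + \<beta>\<^sup>2) * k M N - (\<alpha> * (2 * M - 1) + \<beta> * (2 * N - 1))"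
      using p3 prime_dvd_mult_iff[of "3 :: int"] by auto
    \<comment> \<open>Modulo 3 the assumption reduces to \<beta> l = 2 N - 1, so N - \<beta> l
      becomes 1 - N. The variables are general because the coordinates are used in both
      orders.\<close>
    have flip: "3 dvd (N - \<beta> * l) + N - 1 \<and> 3 dvd (M - \<alpha> * l) - M"
      if \<alpha>: "3 dvd \<alpha>" and \<beta>: "\<not> 3 dvd \<beta>" and l: "3 dvd (\<alpha>\<^sup>2 + \<beta>\<^sup>2) * l - (\<alpha> * (2 * M - 1) + \<beta> * (2 * N - 1))"
      for \<alpha> \<beta> l M N :: int
    proof -
      obtain c where c: "\<alpha> = 3 * c"
        using \<alpha> by blast
      obtain e where "(\<alpha>\<^sup>2 + \<beta>\<^sup>2) * l - (\<alpha> * (2 * M - 1) + \<beta> * (2 * N - 1)) = 3 * e"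
        using l by blast
      then have "\<beta> * ((N - \<beta> * l) + N - 1) = 3 * (3 * c\<^sup>2 * l - c * (2 * M - 1) - e)"
        unfolding c by algebra
      then have "3 dvd \<beta> * ((N - \<beta> * l) + N - 1)"
        by (metis dvd_triv_left)
      then show ?thesis
        using \<alpha> \<beta> prime_dvd_mult_iff[of "3 :: int"] by auto
    qed
    have flipped: "quint_sign M' * quint_sign N' = - (quint_sign M * quint_sign N)"
    proof (cases "3 dvd \<alpha>")
      case True
      then have "3 dvd N' + N - 1" "3 dvd M' - M"
        using flip[of \<alpha> \<beta> "k M N" M N] one k3 by (auto simp: M'_def N'_def)
      then show ?thesis
        by (metis quint_sign_reflect quint_sign_cong mult_minus_right)
    next
      case False
      then have "3 dvd M' + M - 1" "3 dvd N' - N"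
        using flip[of \<beta> \<alpha> "k M N" N M] one k3 by (auto simp: M'_def N'_def add.commute)
      then show ?thesis
        by (metis quint_sign_reflect quint_sign_cong mult_minus_left)
  qed
    then have sign: "pair_sign (\<sigma> x) = - pair_sign x"
      unfolding \<sigma>x by (simp add: pair_sign_def MN)
    have "quint_sign M \<noteq> 0" "quint_sign N \<noteq> 0" "quint_sign M' \<noteq> 0" "quint_sign N' \<noteq> 0"
      using x(1) flipped by (auto simp: pair_sign_def MN)
    note six = this[THEN quint_exp_times_6]
    \<comment> \<open>After multiplication by 6 both exponents are quadratic polynomials, equal
      because a reflection preserves the distance from the centre.\<close>
    have "6 * pair_exp p b m n (\<sigma> x) = 6 * pair_exp p b m n x"
    proof -
      have "int p * (M' * (M' - 1) + N' * (N' - 1)) + 6 * b * (m * M' + n * N') =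
          int p * (M * (M - 1) + N * (N - 1)) + 6 * b * (m * M + n * N)"
        using k unfolding D_def T_def M'_def N'_def by algebra
      then show ?thesis
        unfolding \<sigma>x pair_exp_def six[symmetric] by (simp add: MN algebra_simps)
    qed
    with sign \<open>\<sigma> (\<sigma> x) = x\<close> show ?thesis
      by simp
  qed
  from coeff_eq_0_if_sign_reversing[OF p a this] show ?thesis .
qed

section \<open>Directions of reflection for \<open>p\<close> modulo 12\<close>

lemma not_dvd_if_cong_inverse:
  fixes p x y :: int
  assumes "prime p" "[x * y = 1] (mod p)"
  shows "\<not> p dvd x"
proof
  assume "p dvd x"
  then have "[x * y = 0] (mod p)"
    by (simp add: cong_0_iff)
  then have "p dvd 1"
    using assms(2) by (metis cong_0_iff cong_sym cong_trans)
  then show False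
    using assms(1) not_prime_unit by blast
qed

text \<open>As m^2 + n^2 is 1 modulo 3, exactly one of m, n is divisible by 3. So the directions
  (-n, m) and (m, n), of squared length p, are admissible; the first serves \<open>b * w\<close>,
  the second \<open>b * (w - 3 * b)\<close>.\<close>

lemma coeff_eq_0_1_mod_12:
  fixes p :: nat and m n b w r t :: int and a :: "int \<Rightarrow> int"
  assumes p: "prime p" "[p = 1] (mod 12)" "int p = m\<^sup>2 + n\<^sup>2"
    and a: "\<And>q :: complex. 0 < norm q \<Longrightarrow> norm q < 1 \<Longrightarrow>
           ((\<lambda>t. of_int (a t) * q powi t) has_sum
              (quintuple (q powi (b * m)) (q ^ p) * quintuple (q powi (b * n)) (q ^ p))) UNIV"
    and pb: "\<not> int p dvd b" and pm: "\<not> int p dvd m"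
    and w: "[2 * w = m + n] (mod int p)"
    and r: "r = b * w \<or> r = b * (w - 3 * b)"
  shows "a (int p * t + r) = 0"
proof -
  have prime: "prime (int p)"
    using p(1) by simp
  have p0: "p > 0"
    using p(1) by (rule prime_gt_0_nat)
  have p3: "int p mod 3 = 1"
    using cong_dvd_modulus_nat[OF p(2), of 3] by (simp add: cong_def) presburger
  have one: "3 dvd m \<longleftrightarrow> \<not> 3 dvd n"
  proof -
    have "(m mod 3 = 0 \<or> m mod 3 = 1 \<or> m mod 3 = 2) \<and> (n mod 3 = 0 \<or> n mod 3 = 1 \<or> n mod 3 = 2)"
      by presburger
    moreover have "((m mod 3)\<^sup>2 + (n mod 3)\<^sup>2) mod 3 = 1"
      using p3 unfolding p(3) by (metis mod_add_eq power_mod)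
    ultimately have "m mod 3 = 0 \<longleftrightarrow> n mod 3 \<noteq> 0"
      by auto
    then show ?thesis
      by presburger
  qed
  obtain e where e: "2 * w = m + n + int p * e"
    using w by (metis cong_iff_lin cong_sym mult.commute)
  show ?thesis
    using r
  proof
    assume r: "r = b * w"
    show ?thesis
    proof (rule coeff_eq_0_if_reflection[OF p0 _ a, where \<alpha> = "- n" and \<beta> = m])
      show "\<not> 3 dvd int p"
        using p3 by presburger
      show "3 dvd - n \<longleftrightarrow> \<not> 3 dvd m"
        using one by simp
    next
      fix M N assume "int p dvd b * (m * M + n * N) - r"
      then have "int p dvd b * (m * M + n * N - w)"
        by (simp add: r right_diff_distrib)
      then obtain f where f: "m * M + n * N - w = int p * f"
        using prime_dvd_multD[OF prime] pb by blast
      \<comment> \<open>With u = 2 M - 1 and v = 2 N - 1, the class condition makes m u + n v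
        divisible by p, and m (m v - n u) = p v - n (m u + n v).\<close>
      have "m * (m * (2 * N - 1) - n * (2 * M - 1)) = int p * (2 * N - 1 - n * (2 * f + e))"
        using f e p(3) by algebra
      then have "int p dvd m * (m * (2 * N - 1) - n * (2 * M - 1))"
        by simp
      then obtain k where k: "m * (2 * N - 1) - n * (2 * M - 1) = int p * k"
        using prime_dvd_multD[OF prime] pm by blast
      have "int p * (- n * (2 * M - 1) + m * (2 * N - 1)) + 6 * b * (m * - n + n * m) =
          int p * ((- n)\<^sup>2 + m\<^sup>2) * k"
        using k p(3) by algebra
      then show "int p * ((- n)\<^sup>2 + m\<^sup>2) dvd
          int p * (- n * (2 * M - 1) + m * (2 * N - 1)) + 6 * b * (m * - n + n * m)"
        by (metis dvd_triv_left)
    qed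
  next
    assume r: "r = b * (w - 3 * b)"
    show ?thesis
    proof (rule coeff_eq_0_if_reflection[OF p0 _ a, where \<alpha> = m and \<beta> = n])
      show "\<not> 3 dvd int p"
        using p3 by presburger
      show "3 dvd m \<longleftrightarrow> \<not> 3 dvd n"
        by (rule one)
    next
      fix M N assume "int p dvd b * (m * M + n * N) - r"
      then have "int p dvd b * (m * M + n * N - (w - 3 * b))"
        by (simp add: r right_diff_distrib)
      then obtain f where f: "m * M + n * N - (w - 3 * b) = int p * f"
        using prime_dvd_multD[OF prime] pb by blast
      \<comment> \<open>Here m (2 M - 1) + n (2 N - 1) is congruent to -6 b modulo p, which offsets
        the contribution 6 b p of the centre.\<close>
      have "int p * (m * (2 * M - 1) + n * (2 * N - 1)) + 6 * b * (m * m + n * n) =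
          int p * (m\<^sup>2 + n\<^sup>2) * (2 * f + e)"
        using f e p(3) by algebra
      then show "int p * (m\<^sup>2 + n\<^sup>2) dvd
          int p * (m * (2 * M - 1) + n * (2 * N - 1)) + 6 * b * (m * m + n * n)"
        by (metis dvd_triv_left)
    qed
  qed
qed

text \<open>As m^2 + n^2 is 2 modulo 3, neither m nor n is divisible by 3, but exactly one of m - n
  and m + n is. Hence the direction (1 + i)(m + n i), of squared length 2 p.\<close>

lemma coeff_eq_0_5_mod_12:
  fixes p :: nat and m n b w m' t :: int and a :: "int \<Rightarrow> int"
  assumes p: "prime p" "[p = 5] (mod 12)" "int p = m\<^sup>2 + n\<^sup>2"
    and a: "\<And>q :: complex. 0 < norm q \<Longrightarrow> norm q < 1 \<Longrightarrow>
           ((\<lambda>t. of_int (a t) * q powi t) has_sum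
              (quintuple (q powi (b * m)) (q ^ p) * quintuple (q powi (b * n)) (q ^ p))) UNIV"
    and pb: "\<not> int p dvd b"
    and w: "[2 * w = m + n] (mod int p)" and m': "[m * m' = 1] (mod int p)"
  shows "a (int p * t + b * w * (1 - 3 * b * m')) = 0"
proof -
  have prime: "prime (int p)"
    using p(1) by simp
  have p0: "p > 0"
    using p(1) by (rule prime_gt_0_nat)
  have p3: "int p mod 3 = 2"
    using cong_dvd_modulus_nat[OF p(2), of 3] by (simp add: cong_def) presburger
  have odd: "odd (int p)"
    using cong_dvd_modulus_nat[OF p(2), of 2] by (simp add: cong_def odd_iff_mod_2_eq_one)
  have one: "3 dvd m - n \<longleftrightarrow> \<not> 3 dvd m + n"
  proof -
    have "(m mod 3 = 0 \<or> m mod 3 = 1 \<or> m mod 3 = 2) \<and> (n mod 3 = 0 \<or> n mod 3 = 1 \<or> n mod 3 = 2)"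
      by presburger
    moreover have "((m mod 3)\<^sup>2 + (n mod 3)\<^sup>2) mod 3 = 2"
      using p3 unfolding p(3) by (metis mod_add_eq power_mod)
    ultimately have "(m mod 3 = 1 \<or> m mod 3 = 2) \<and> (n mod 3 = 1 \<or> n mod 3 = 2)"
      by auto
    then show ?thesis
      by presburger
  qed
  obtain e where e: "2 * w = m + n + int p * e"
    using w by (metis cong_iff_lin cong_sym mult.commute)
  obtain g where g: "m * m' = 1 + int p * g"
    using m' by (metis cong_iff_lin cong_sym mult.commute)
  have pm: "\<not> int p dvd m"
    using prime m' by (rule not_dvd_if_cong_inverse)
  show ?thesis
  proof (rule coeff_eq_0_if_reflection[OF p0 _ a, where \<alpha> = "m - n" and \<beta> = "m + n"])
    show "\<not> 3 dvd int p"
      using p3 by presburger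
    show "3 dvd m - n \<longleftrightarrow> \<not> 3 dvd m + n"
      by (rule one)
  next
    fix M N assume "int p dvd b * (m * M + n * N) - b * w * (1 - 3 * b * m')"
    then have "int p dvd b * (m * M + n * N - w * (1 - 3 * b * m'))"
      by (simp add: right_diff_distrib mult.assoc)
    then obtain f where f: "m * M + n * N - w * (1 - 3 * b * m') = int p * f"
      using prime_dvd_multD[OF prime] pb by blast
    \<comment> \<open>The quantity to be divided by 2 p^2 equals 2 p X, so it suffices that p
      divides X.\<close>
    define X where "X = 3 * b + (m - n) * M + (m + n) * N - m"
    \<comment> \<open>\<open>f1\<close> is \<open>m u + n v \<equiv> - 3 b (1 + n / m)\<close> for \<open>u = 2 M - 1\<close>, \<open>v = 2 N - 1\<close>, cleared of
      denominators; \<open>f2\<close> expresses \<open>m v - n u \<equiv> - (n / m) (m u + n v)\<close>, as \<open>n / m\<close> is a square root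
      of \<open>-1\<close>.\<close>
    have f1: "m * (m * (2 * M - 1) + n * (2 * N - 1)) =
        - 3 * b * (m + n) + int p * (2 * m * f + e * m - 3 * b * e * (m * m') - 3 * b * (m + n) * g)"
      using f e g by algebra
    have f2: "m * (m * (2 * N - 1) - n * (2 * M - 1)) =
        - n * (m * (2 * M - 1) + n * (2 * N - 1)) + int p * (2 * N - 1)"
      using p(3) by algebra
    \<comment> \<open>By \<open>f1\<close> and \<open>f2\<close>, the part without an explicit
      factor p is 6 b m^2 - 3 b (m - n)(m + n) = 3 b (m^2 + n^2) = 3 b p.\<close>
    have "2 * (m * m) * X = int p * (3 * b + m * (2 * N - 1) +
        (m - n) * (2 * m * f + e * m - 3 * b * e * (m * m') - 3 * b * (m + n) * g))"
      using f1 f2 p(3) unfolding X_def by algebra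
    then have "int p dvd 2 * (m * m) * X"
      by (metis dvd_triv_left)
    moreover have "\<not> int p dvd 2"
    proof
      assume "int p dvd 2"
      then have "int p \<le> 2"
        by (rule zdvd_imp_le) simp
      then show False
        using p3 odd p0 by presburger
    qed
    ultimately obtain k where k: "X = int p * k"
      using prime_dvd_multD[OF prime] pm by blast
    have "int p * ((m - n) * (2 * M - 1) + (m + n) * (2 * N - 1)) + 6 * b * (m * (m - n) + n * (m + n)) =
        int p * ((m - n)\<^sup>2 + (m + n)\<^sup>2) * k"
      using k p(3) unfolding X_def by algebra
    then show "int p * ((m - n)\<^sup>2 + (m + n)\<^sup>2) dvd int p * ((m - n) * (2 * M - 1) + (m + n) * (2 * N - 1)) +
        6 * b * (m * (m - n) + n * (m + n))"
      by (metis dvd_triv_left)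
  qed
qed

theorem theorem1p1:
  fixes p :: nat and m n b w m' n' :: int and a :: "int \<Rightarrow> int"
  assumes "prime p" and "[p = 1] (mod 4)"
    and "int p = m\<^sup>2 + n\<^sup>2"
    and "b > 0"
    and "\<And>q :: complex. 0 < norm q \<Longrightarrow> norm q < 1 \<Longrightarrow>
           ((\<lambda>t. of_int (a t) * q powi t) has_sum
              (quintuple (q powi (b * m)) (q ^ p) * quintuple (q powi (b * n)) (q ^ p))) UNIV"
    and "[2 * w = m + n] (mod int p)"
    and "[m * m' = 1] (mod int p)" and "[n * n' = 1] (mod int p)"
  shows "([p = 1] (mod 12) \<longrightarrow>
            (\<forall>t. a (int p * t + b * w) = 0 \<and> a (int p * t + b * (w - 3 * b)) = 0)) \<and>
         ([p = 5] (mod 12) \<longrightarrow>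
            (\<forall>t. a (int p * t + b * w * (1 - 3 * b * m')) = 0 \<and>
                 a (int p * t + b * w * (1 - 3 * b * n')) = 0))"
proof (cases "int p dvd b")
  case True
  \<comment> \<open>The product vanishes identically here; the reflection used is \<open>M \<mapsto> 1 - M - 6 b m / p\<close>.\<close>
  have "a (int p * t + r) = 0" if "\<not> 3 dvd int p" for t r
  proof (rule coeff_eq_0_if_reflection[OF _ that assms(5), where \<alpha> = 1 and \<beta> = 0])
    show "int p * (1\<^sup>2 + 0\<^sup>2) dvd int p * (1 * (2 * M - 1) + 0 * (2 * N - 1)) + 6 * b * (m * 1 + n * 0)"
      for M N
      using True by simp
  qed (use assms(1) prime_gt_0_nat in auto)
  moreover have "\<not> 3 dvd int p" if "[p = 1] (mod 12) \<or> [p = 5] (mod 12)"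
  proof -
    have "[p = 1] (mod 3) \<or> [p = 5] (mod 3)"
      using that cong_dvd_modulus_nat[of p _ 12 3] by auto
    then have "\<not> 3 dvd p"
      by (auto simp: cong_def dvd_eq_mod_eq_0)
    then show ?thesis
      by presburger
  qed
  ultimately show ?thesis
    by blast
next
  \<comment> \<open>Now \<open>b\<close> can be cancelled from the class conditions modulo
    \<open>p\<close>.\<close>
  case False
  have pm: "\<not> int p dvd m"
    using assms(1,7) by (intro not_dvd_if_cong_inverse) auto
  have swapped: "((\<lambda>t. of_int (a t) * q powi t) has_sum
      (quintuple (q powi (b * n)) (q ^ p) * quintuple (q powi (b * m)) (q ^ p))) UNIV"
    if "0 < norm q" "norm q < 1" for q :: complex
    using assms(5)[OF that] by (simp add: mult.commute)
  \<comment> \<open>Exchanging \<open>m\<close> and \<open>n\<close> turns the claim for the inverse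
    \<open>m'\<close> into the one for \<open>n'\<close>.\<close>
  have "int p = n\<^sup>2 + m\<^sup>2" "[2 * w = n + m] (mod int p)"
    using assms(3,6) by (simp_all add: add.commute)
  note swap_5 = coeff_eq_0_5_mod_12[OF assms(1) _ this(1) swapped False this(2) assms(8)]
  note no_swap_5 = coeff_eq_0_5_mod_12[OF assms(1) _ assms(3,5) False assms(6,7)]
  note mod_1 = coeff_eq_0_1_mod_12[OF assms(1) _ assms(3,5) False pm assms(6)]
  show ?thesis
    using swap_5 no_swap_5 mod_1 by blast
qed

end
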